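(* Let $k$ be an integer and $x$ a real number with $x \geq k-1 \geq 2$. Let $\mathcal{H}$ be a nonempty $k$-uniform hypergraph with degree bound $d$, where $d \leq \binom{x}{k-1}$. Then $$\frac{|\sigma(\mathcal{H})|}{|\mathcal{H}|} \geq \frac{k}{x-k+2}.$$
   Context: A $k$-uniform hypergraph on $[n]=\{1,\ldots,n\}$ ($n$ a positive integer) is a family $\mathcal{H} \subset \binom{[n]}{k}$ of $k$-element subsets of $[n]$, called hyperedges; $|\mathcal{H}|$ is the number of hyperedges. The shadow of $\mathcal{H}$ is $\sigma(\mathcal{H}) = \{S \in \binom{[n]}{k-1} : \exists H \in \mathcal{H},\ S \subset H\}$. The maximum degree is $\Delta(\mathcal{H}) = \max_{v \in [n]} |\{H \in \mathcal{H} : v \in H\}|$, and a degree bound of $\mathcal{H}$ is any real number $d$ with $\Delta(\mathcal{H}) \leq d$. For a real number $x$ and positive integer $j$, $\binom{x}{j} = \frac{x(x-1)\cdots(x-j+1)}{j!}$. *)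

theory Defs
  imports Complex_Main "HOL-Library.Ramsey"
begin

text \<open>The vertex set \<open>[n]\<close> is \<open>{1..n}\<close>; the family of \<open>k\<close>-element subsets of a set \<open>A\<close> is
  \<^term>\<open>nsets A k\<close>.\<close>

definition uniform_hypergraph :: "nat \<Rightarrow> nat \<Rightarrow> nat set set \<Rightarrow> bool" where
  "uniform_hypergraph n k \<H> \<longleftrightarrow> n > 0 \<and> \<H> \<subseteq> nsets {1..n} k"

definition shadow :: "nat \<Rightarrow> nat \<Rightarrow> nat set set \<Rightarrow> nat set set" where
  "shadow n k \<H> = {S \<in> nsets {1..n} (k - 1). \<exists>H\<in>\<H>. S \<subseteq> H}"

definition degree :: "nat set set \<Rightarrow> nat \<Rightarrow> nat" where
  "degree \<H> v = card {H \<in> \<H>. v \<in> H}"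

definition max_degree :: "nat \<Rightarrow> nat set set \<Rightarrow> nat" where
  "max_degree n \<H> = Max (degree \<H> ` {1..n})"

definition degree_bound :: "nat \<Rightarrow> nat set set \<Rightarrow> real \<Rightarrow> bool" where
  "degree_bound n \<H> d \<longleftrightarrow> real (max_degree n \<H>) \<le> d"

end

theory Submission
  imports Defs
begin

text \<open>
  The degree bound is a bound on the sizes of the vertex links of \<open>\<H>\<close>, and the links turn the
  local statement into the global one.  The link of \<open>v\<close> is a \<open>(k-1)\<close>-uniform family with at most
  \<open>x gchoose (k-1)\<close> members, so the Lovasz form of the Kruskal--Katona theorem
  (\<open>lovasz_shadow_bound\<close>) bounds its shadow from below by \<open>(k-1)/(x-k+2)\<close> times its size.  The
  shadow of the link of \<open>v\<close> lies in the link of \<open>v\<close> in the shadow.  Summing over all vertices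
  counts every hyperedge \<open>k\<close> times and every member of the shadow \<open>k-1\<close> times
  (\<open>sum_card_link\<close>), and the factor \<open>k-1\<close> cancels.

  The Kruskal--Katona bound is itself obtained from links, by an induction due to Keevash
  that needs no compressions (\<open>clique_count_bound\<close>): it bounds from above the number of
  \<open>(r+1)\<close>-sets all of whose \<open>r\<close>-subsets lie in a given \<open>r\<close>-uniform family \<open>G\<close>.  At a vertex of
  small degree the induction hypothesis applies to the link; at a vertex of large degree few
  members of \<open>G\<close> are left that avoid the vertex, and each \<open>(r+1)\<close>-set through it uses one of them.

  Both bounds are stated as ratios, \<open>(r+1) |F| \<le> (x-r) |G|\<close>, for every real \<open>x\<close> that is large
  enough, and not as \<open>|F| \<le> x gchoose (r+1)\<close> for the \<open>x\<close> with \<open>|G| = x gchoose r\<close>.  The ratio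
  form is what is additive over vertices, and it avoids solving for \<open>x\<close>.
\<close>

definition link :: "'a set set \<Rightarrow> 'a \<Rightarrow> 'a set set" where
  "link F v = (\<lambda>A. A - {v}) ` {A \<in> F. v \<in> A}"

text \<open>\<open>G\<close> may be larger than the shadow of \<open>F\<close>: counting the sets \<open>A\<close> all of whose
  \<open>A - {a}\<close> lie in a given \<open>G\<close> needs this freedom, and the relation passes to links as it is.\<close>

definition shadow_within :: "'a set set \<Rightarrow> 'a set set \<Rightarrow> bool" where
  "shadow_within F G \<longleftrightarrow> (\<forall>A\<in>F. \<forall>a\<in>A. A - {a} \<in> G)"

lemma inj_on_remove: "inj_on (\<lambda>A. A - {v}) {A \<in> F. v \<in> A}"
  by (rule inj_onI) blast

lemma card_link: "card (link F v) = card {A \<in> F. v \<in> A}"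
  unfolding link_def by (rule card_image[OF inj_on_remove])

lemma link_subset_nsets:
  assumes "F \<subseteq> nsets V (Suc r)"
  shows "link F v \<subseteq> nsets V r"
  using assms by (auto simp: link_def nsets_def card_Diff_singleton)

lemma shadow_within_link:
  assumes "shadow_within F G"
  shows "shadow_within (link F v) (link G v)"
  unfolding shadow_within_def
proof (intro ballI)
  fix B a assume "B \<in> link F v" and a: "a \<in> B"
  then obtain A where A: "A \<in> F" "v \<in> A" "B = A - {v}"
    by (auto simp: link_def)
  with a have "A - {a} \<in> G" "v \<in> A - {a}"
    using assms by (auto simp: shadow_within_def)
  moreover have "B - {a} = (A - {a}) - {v}"
    using A by blast
  ultimately show "B - {a} \<in> link G v"
    by (auto simp: link_def)
qed

lemma finite_uniform_family:
  assumes "finite V" and "F \<subseteq> nsets V r"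
  shows "finite F"
  using assms finite_imp_finite_nsets finite_subset by blast

lemma sum_card_link:
  assumes "finite V" and "F \<subseteq> nsets V r"
  shows "(\<Sum>v\<in>V. card (link F v)) = r * card F"
proof -
  have fin: "finite F"
    using finite_uniform_family[OF assms] .
  have "(\<Sum>v\<in>V. card (link F v)) = (\<Sum>v\<in>V. \<Sum>A\<in>F. if v \<in> A then 1 else 0)"
    using fin by (simp add: card_link sum.If_cases Int_def)
  also have "\<dots> = (\<Sum>A\<in>F. \<Sum>v\<in>V. if v \<in> A then 1 else 0)"
    by (rule sum.swap)
  also have "\<dots> = (\<Sum>A\<in>F. r)"
  proof (rule sum.cong[OF refl])
    fix A assume "A \<in> F"
    then have "A \<subseteq> V" "card A = r"
      using assms(2) by (auto simp: nsets_def)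
    then show "(\<Sum>v\<in>V. if v \<in> A then 1 else 0) = r"
      using assms(1) by (simp add: sum.If_cases Int_absorb1)
  qed
  finally show ?thesis by simp
qed

text \<open>The members of \<open>F\<close> through \<open>v\<close> and the members of \<open>G\<close> through \<open>v\<close> compete for room in \<open>G\<close>,
  since deleting \<open>v\<close> from the former gives distinct members of \<open>G\<close> that avoid \<open>v\<close>.\<close>

lemma card_link_add_le:
  assumes "finite G" and "shadow_within F G"
  shows "card (link F v) + card (link G v) \<le> card G"
proof -
  have "link F v \<subseteq> {A \<in> G. v \<notin> A}"
    using assms(2) by (auto simp: link_def shadow_within_def)
  then have "card (link F v) \<le> card {A \<in> G. v \<notin> A}"
    using assms(1) by (simp add: card_mono)
  moreover have "card {A \<in> G. v \<notin> A} + card {A \<in> G. v \<in> A} = card G"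
    using assms(1) by (subst card_Un_disjoint[symmetric]) (auto intro!: arg_cong[of _ _ card])
  ultimately show ?thesis
    by (simp add: card_link)
qed

lemma gbinomial_Suc_ratio:
  fixes x :: real
  shows "real (Suc r) * (x gchoose Suc r) = (x - real r) * (x gchoose r)"
  using gbinomial_mult_1[of x r] by (simp add: algebra_simps)

text \<open>With \<open>c = x gchoose r\<close> as the threshold for the degree of \<open>v\<close> in \<open>G\<close>, Pascal's rule
  leaves at most \<open>x gchoose (r+1)\<close> members of \<open>G\<close> that avoid \<open>v\<close>, and this number is
  \<open>(x-r)/(r+1)\<close> times \<open>c\<close>.\<close>

lemma link_bound_large_degree:
  fixes x :: real
  assumes "finite G" and "shadow_within F G" and "x \<ge> real r"
    and "real (card G) \<le> (x + 1) gchoose Suc r"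
    and "x gchoose r \<le> real (card (link G v))"
  shows "real (Suc r) * real (card (link F v)) \<le> (x - real r) * real (card (link G v))"
proof -
  have "real (card (link F v)) + real (card (link G v)) \<le> (x + 1) gchoose Suc r"
    using card_link_add_le[OF assms(1,2), of v] assms(4) by linarith
  then have "real (card (link F v)) \<le> x gchoose Suc r"
    using assms(5) gbinomial_Suc_Suc[of x r] by linarith
  then have "real (Suc r) * real (card (link F v)) \<le> real (Suc r) * (x gchoose Suc r)"
    by (intro mult_left_mono) auto
  also have "\<dots> = (x - real r) * (x gchoose r)"
    by (rule gbinomial_Suc_ratio)
  also have "\<dots> \<le> (x - real r) * real (card (link G v))"
    using assms(3,5) by (intro mult_left_mono) auto
  finally show ?thesis .
qed

lemma sum_link_bounds:
  fixes a b :: real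
  assumes "finite V" and "F \<subseteq> nsets V s" and "G \<subseteq> nsets V r"
    and "\<And>v. v \<in> V \<Longrightarrow> a * real (card (link F v)) \<le> b * real (card (link G v))"
  shows "a * (real s * real (card F)) \<le> b * (real r * real (card G))"
proof -
  have "a * (real s * real (card F)) = (\<Sum>v\<in>V. a * real (card (link F v)))"
    unfolding sum_distrib_left[symmetric]
    by (simp only: sum_card_link[OF assms(1,2)] flip: of_nat_sum of_nat_mult)
  also have "\<dots> \<le> (\<Sum>v\<in>V. b * real (card (link G v)))"
    using assms(4) by (rule sum_mono)
  also have "\<dots> = b * (real r * real (card G))"
    unfolding sum_distrib_left[symmetric]
    by (simp only: sum_card_link[OF assms(1,3)] flip: of_nat_sum of_nat_mult)
  finally show ?thesis .
qed

text \<open>The induction starts at uniformity one: for \<open>G = {{}}\<close> the members of \<open>F\<close> can be arbitrarily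
  many singletons.  At uniformity one a vertex of small degree has degree zero, so no member of
  \<open>F\<close> contains it.  The real parameter drops by one together with the uniformity, so that
  \<open>x - r\<close>, and with it the bound at every vertex, is preserved.\<close>

lemma clique_count_bound:
  fixes x :: real
  assumes "finite V" and "F \<subseteq> nsets V (Suc (Suc r))" and "G \<subseteq> nsets V (Suc r)"
    and "shadow_within F G" and "x \<ge> real (Suc r)" and "real (card G) \<le> x gchoose Suc r"
  shows "real (Suc (Suc r)) * real (card F) \<le> (x - real (Suc r)) * real (card G)"
  using assms
proof (induction r arbitrary: x F G)
  case (0 x F G)
  have finG: "finite G"
    using finite_uniform_family[OF 0(1,3)] .
  have "1 * real (card (link F v)) \<le> (x - 1) * real (card (link G v))" for v
  proof (cases "card (link G v) = 0")
    case True
    have "finite (link G v)"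
      using finG by (simp add: link_def)
    with True have "{A \<in> G. v \<in> A} = {}"
      by (simp add: link_def)
    have "{A \<in> F. v \<in> A} = {}"
    proof safe
      fix A assume A: "A \<in> F" "v \<in> A"
      then have "card A = 2"
        using 0(2) by (auto simp: nsets_def)
      then obtain w where "w \<in> A" "w \<noteq> v"
        by (auto simp: card_2_iff)
      then have "A - {w} \<in> {A \<in> G. v \<in> A}"
        using A 0(4) by (auto simp: shadow_within_def)
      then show "A \<in> {}"
        using \<open>{A \<in> G. v \<in> A} = {}\<close> by blast
    qed
    then have "card (link F v) = 0"
      by (simp add: link_def del: Collect_empty_eq)
    then show ?thesis
      using True by simp
  next
    case False
    then show ?thesis
      using link_bound_large_degree[OF finG 0(4), of 0 "x - 1" v] 0(5,6) by simp
  qed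
  then show ?case
    using sum_link_bounds[OF 0(1-3), of 1 "x - 1"] by simp
next
  case (Suc r x F G)
  have finG: "finite G"
    using finite_uniform_family[OF Suc.prems(1,3)] .
  let ?s = "real (Suc (Suc r))"
  have "?s * real (card (link F v)) \<le> (x - ?s) * real (card (link G v))" for v
  proof (cases "x - 1 gchoose Suc r \<le> real (card (link G v))")
    case True
    then show ?thesis
      using link_bound_large_degree[OF finG Suc.prems(4), of "Suc r" "x - 1" v] Suc.prems(5,6)
      by (simp add: algebra_simps)
  next
    case False
    then show ?thesis
      using Suc.IH[of "link F v" "link G v" "x - 1"] Suc.prems
      by (simp add: link_subset_nsets shadow_within_link algebra_simps)
  qed
  then have "?s * (real (Suc (Suc (Suc r))) * real (card F)) \<le> (x - ?s) * (?s * real (card G))"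
    by (rule sum_link_bounds[OF Suc.prems(1-3)])
  then have "?s * (real (Suc (Suc (Suc r))) * real (card F)) \<le> ?s * ((x - ?s) * real (card G))"
    by (simp add: mult.left_commute)
  then show ?case
    by (rule mult_left_le_imp_le) simp
qed

text \<open>Here the size of \<open>F\<close> is bounded and not that of \<open>G\<close>.  If \<open>G\<close> is small as well, the previous
  bound applies; if \<open>G\<close> is large, its size and that of \<open>F\<close> compare directly.\<close>

lemma lovasz_shadow_bound:
  fixes x :: real
  assumes "finite V" and "F \<subseteq> nsets V (Suc (Suc r))" and "G \<subseteq> nsets V (Suc r)"
    and "shadow_within F G" and "x \<ge> real (Suc r)" and "real (card F) \<le> x gchoose Suc (Suc r)"
  shows "real (Suc (Suc r)) * real (card F) \<le> (x - real (Suc r)) * real (card G)"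
proof (cases "real (card G) \<le> x gchoose Suc r")
  case True
  then show ?thesis
    using clique_count_bound assms(1-5) by blast
next
  case False
  have "real (Suc (Suc r)) * real (card F) \<le> real (Suc (Suc r)) * (x gchoose Suc (Suc r))"
    using assms(6) by (intro mult_left_mono) auto
  also have "\<dots> = (x - real (Suc r)) * (x gchoose Suc r)"
    by (rule gbinomial_Suc_ratio)
  also have "\<dots> \<le> (x - real (Suc r)) * real (card G)"
    using False assms(5) by (intro mult_left_mono) auto
  finally show ?thesis .
qed

lemma shadow_within_shadow:
  assumes "\<H> \<subseteq> nsets {1..n} k"
  shows "shadow_within \<H> (shadow n k \<H>)"
  using assms by (fastforce simp: shadow_within_def shadow_def nsets_def card_Diff_singleton)

lemma card_link_le_degree_bound:
  assumes "degree_bound n \<H> d" and "v \<in> {1..n}"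
  shows "real (card (link \<H> v)) \<le> d"
proof -
  have "card (link \<H> v) \<le> max_degree n \<H>"
    unfolding max_degree_def card_link degree_def[symmetric]
    using assms(2) by (intro Max_ge) auto
  then show ?thesis
    using assms(1) unfolding degree_bound_def by linarith
qed

theorem theorem1p4:
  fixes n k :: nat and x d :: real and \<H> :: "nat set set"
  assumes "x \<ge> real k - 1" and "real k - 1 \<ge> 2"
    and "uniform_hypergraph n k \<H>" and "\<H> \<noteq> {}"
    and "degree_bound n \<H> d" and "d \<le> x gchoose (k - 1)"
  shows "real (card (shadow n k \<H>)) / real (card \<H>) \<ge> real k / (x - real k + 2)"
proof -
  have "k \<ge> 3"
    using assms(2) by linarith
  then obtain r where k: "k = Suc (Suc (Suc r))"
    by (metis add_Suc le_Suc_ex numeral_3_eq_3 add_0)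
  let ?s = "real (Suc (Suc r))" and ?V = "{1..n}" and ?S = "shadow n k \<H>"
  have H: "\<H> \<subseteq> nsets ?V (Suc (Suc (Suc r)))"
    using assms(3) by (simp add: uniform_hypergraph_def k)
  have S: "?S \<subseteq> nsets ?V (Suc (Suc r))"
    by (auto simp: shadow_def k)
  have HS: "shadow_within \<H> ?S"
    using shadow_within_shadow H k by blast
  have "?s * real (card (link \<H> v)) \<le> (x - real (Suc r)) * real (card (link ?S v))"
    if v: "v \<in> ?V" for v
  proof (rule lovasz_shadow_bound[where V = "?V"])
    show "link \<H> v \<subseteq> nsets ?V (Suc (Suc r))" "link ?S v \<subseteq> nsets ?V (Suc r)"
      by (rule link_subset_nsets[OF H], rule link_subset_nsets[OF S])
    show "shadow_within (link \<H> v) (link ?S v)"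
      using HS by (rule shadow_within_link)
    show "real (card (link \<H> v)) \<le> x gchoose Suc (Suc r)"
      using card_link_le_degree_bound[OF assms(5) v] assms(6) by (simp add: k)
    show "x \<ge> real (Suc r)"
      using assms(1) by (simp add: k)
  qed simp
  then have "?s * (real k * real (card \<H>)) \<le> (x - real (Suc r)) * (?s * real (card ?S))"
    using sum_link_bounds[OF _ H S] by (simp add: k)
  then have "?s * (real k * real (card \<H>)) \<le> ?s * ((x - real (Suc r)) * real (card ?S))"
    by (simp add: mult.left_commute)
  then have "real k * real (card \<H>) \<le> (x - real (Suc r)) * real (card ?S)"
    by (rule mult_left_le_imp_le) simp
  also have "x - real (Suc r) = x - real k + 2"
    by (simp add: k)
  finally have "real k * real (card \<H>) \<le> real (card ?S) * (x - real k + 2)"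
    by (simp only: mult.commute)
  moreover have "x - real k + 2 > 0"
    using assms(1) by linarith
  moreover have "real (card \<H>) > 0"
    using finite_uniform_family[OF _ H] assms(4) by (simp add: card_gt_0_iff)
  ultimately show ?thesis
    by (simp add: divide_simps)
qed

end
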